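(* Let $(X,\|\cdot\|)$ be a Banach space with an additional locally convex topology $\tau$ satisfying conditions (i)--(iii) of the context, let $X^\circ$ be the closed subspace of $X'$ defined in the context, and let $\tau^\circ:=\sigma(X^\circ,X)$. Suppose that (A) $X^\circ\cap\overline{B(0,1)}$ (the closed unit ball of $X^\circ$) is sequentially complete for $\sigma(X^\circ,X)$; and (B) every norm-bounded sequence $(\varphi_n)\subset X^\circ$ which is $\tau^\circ$-null is $\tau$-equicontinuous on norm-bounded sets of $X$. Let $(T(t))_{t\ge0}$ be a $\tau$-bi-continuous semigroup on $X$. Then the semigroup $(T^\circ(t))_{t\ge0}$, where $T^\circ(t):=T(t)'|_{X^\circ}$, is a $\tau^\circ$-bi-continuous semigroup on $X^\circ$.
   Context: Conditions on a Banach space $(X,\|\cdot\|)$ with an additional locally convex topology $\tau$: (i) $\tau$ is Hausdorff and coarser than the norm topology. (ii) The locally convex space $(X,\tau)$ is sequentially complete on $\tau$-closed, norm-bounded sets. (iii) The dual $(X,\tau)'$ is norming for $(X,\|\cdot\|)$, i.e. $\|x\|=\sup\{|\varphi(x)| : \varphi\in (X,\tau)',\ \|\varphi\|\le 1\}$ for all $x\in X$. A (one-parameter) semigroup $(T(t))_{t\ge0}$ of bounded linear operators on such an $X$ ($T(0)=I$, $T(t+s)=T(t)T(s)$) is called $\tau$-bi-continuous if: (a) for every $x\in X$ the orbit $t\mapsto T(t)x$ is $\tau$-continuous on $[0,\infty)$; (b) $t\mapsto T(t)$ is norm-bounded on $[0,1]$ (hence exponentially bounded); (c) it is locally bi-equicontinuous: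 for every norm-bounded sequence $(x_n)$ with $x_n\to0$ in $\tau$, $T(t)x_n\to0$ in $\tau$ uniformly for $t$ in compact subintervals of $[0,\infty)$. $X^\circ$ is the set of all norm-bounded linear functionals $\varphi\in X'$ which are $\tau$-sequentially continuous on norm-bounded sets, i.e. $\varphi(x_n)\to\varphi(x)$ whenever $(x_n)$ is norm-bounded and $x_n\to x$ in $\tau$. It is a closed subspace of the norm dual $X'$ and carries the norm of $X'$. For a bounded operator $B$ on $X$ that is $\tau$-sequentially continuous on norm-bounded sets, the Banach space adjoint $B'$ leaves $X^\circ$ invariant, so $T(t)'|_{X^\circ}$ is an operator on $X^\circ$. The notion of $\tau^\circ$-bi-continuous semigroup on $X^\circ$ is the definition above applied to the Banach space $X^\circ$ with the additional topology $\tau^\circ$ (under assumption (A) this pair satisfies conditions (i)--(iii)). A sequence $(\varphi_n)\subset X^\circ$ is $\tau$-equicontinuous on norm-bounded sets if for every norm-bounded set $D\subseteq X$, every $x_0\in D$ and every $\varepsilon>0$ there is a $\tau$-neighbourhood $U$ of $x_0$ such that $|\varphi_n(x)-\varphi_n(x_0)|\le\varepsilon$ for all $x\in U\cap D$ and all $n$. *)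

theory Defs
  imports "HOL-Analysis.Analysis"
begin

text \<open>
  The scalar field is left generic. A complete \<^class>\<open>real_normed_field\<close> is, up to
  isometric isomorphism, \<open>\<real>\<close> or \<open>\<complex>\<close> (Gelfand--Mazur), so \<open>'k\<close> covers exactly these two
  cases. The scalar multiplication is an explicit parameter extending the real one of the type
  class, and spaces are subspaces \<open>S\<close> of a normed type, so that the same definitions apply to
  \<open>X\<close> (as \<^term>\<open>UNIV\<close>) and to the subspace \<open>X\<^sup>\<circ>\<close> of its norm dual.
\<close>

locale normed_space_over =
  vector_space scaleK
  for scaleK :: "'k::{real_normed_field,banach} \<Rightarrow> 'a::real_normed_vector \<Rightarrow> 'a" +
  assumes scale_of_real: "scaleK (of_real r) x = r *\<^sub>R x"
    and norm_scale: "norm (scaleK c x) = norm c * norm x"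

definition linear_map_on ::
  "('k \<Rightarrow> 'a \<Rightarrow> 'a) \<Rightarrow> ('k \<Rightarrow> 'b \<Rightarrow> 'b) \<Rightarrow> 'a::ab_group_add set \<Rightarrow> ('a \<Rightarrow> 'b::ab_group_add) \<Rightarrow> bool"
  where "linear_map_on s1 s2 S f \<longleftrightarrow>
    (\<forall>x\<in>S. \<forall>y\<in>S. f (x + y) = f x + f y) \<and> (\<forall>c. \<forall>x\<in>S. f (s1 c x) = s2 c (f x))"

definition bounded_operator_on :: "('k \<Rightarrow> 'a \<Rightarrow> 'a) \<Rightarrow> 'a::real_normed_vector set \<Rightarrow> ('a \<Rightarrow> 'a) \<Rightarrow> bool"
  where "bounded_operator_on scaleK S B \<longleftrightarrow>
    B ` S \<subseteq> S \<and> linear_map_on scaleK scaleK S B \<and> (\<exists>M. \<forall>x\<in>S. norm (B x) \<le> M * norm x)"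

definition locally_convex_topology ::
  "('k::topological_space \<Rightarrow> 'a \<Rightarrow> 'a) \<Rightarrow> 'a::real_vector set \<Rightarrow> 'a topology \<Rightarrow> bool"
  where "locally_convex_topology scaleK S \<tau> \<longleftrightarrow>
    topspace \<tau> = S \<and>
    continuous_map (prod_topology \<tau> \<tau>) \<tau> (\<lambda>(x, y). x + y) \<and>
    continuous_map (prod_topology euclidean \<tau>) \<tau> (\<lambda>(c, x). scaleK c x) \<and>
    (\<forall>U. openin \<tau> U \<and> 0 \<in> U \<longrightarrow> (\<exists>V. openin \<tau> V \<and> convex V \<and> 0 \<in> V \<and> V \<subseteq> U))"

text \<open>Cauchy sequences refer to the uniformity given by the neighbourhoods of \<open>0\<close>.\<close>

definition topological_Cauchy :: "'a::ab_group_add topology \<Rightarrow> (nat \<Rightarrow> 'a) \<Rightarrow> bool"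
  where "topological_Cauchy \<tau> x \<longleftrightarrow>
    (\<forall>U. openin \<tau> U \<and> 0 \<in> U \<longrightarrow> (\<exists>N. \<forall>m\<ge>N. \<forall>n\<ge>N. x m - x n \<in> U))"

definition sequentially_complete_in :: "'a::ab_group_add topology \<Rightarrow> 'a set \<Rightarrow> bool"
  where "sequentially_complete_in \<tau> C \<longleftrightarrow>
    (\<forall>x. range x \<subseteq> C \<and> topological_Cauchy \<tau> x \<longrightarrow> (\<exists>l\<in>C. limitin \<tau> x l sequentially))"

definition topological_dual ::
  "('k::real_normed_field \<Rightarrow> 'a \<Rightarrow> 'a) \<Rightarrow> 'a::ab_group_add set \<Rightarrow> 'a topology \<Rightarrow> ('a \<Rightarrow> 'k) set"
  where "topological_dual scaleK S \<tau> =
    {\<phi>. linear_map_on scaleK (*) S \<phi> \<and> continuous_map \<tau> euclidean \<phi>}"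

text \<open>
  A Banach space \<open>S\<close> with an additional locally convex topology satisfying (i)--(iii). In
  \<open>norming\<close>, the condition \<open>\<forall>y\<in>S. norm (\<phi> y) \<le> norm y\<close> says that the norm of \<open>\<phi>\<close> as a
  functional on \<open>S\<close> is at most \<open>1\<close>.
\<close>

locale bi_admissible_space =
  normed_space_over scaleK
  for scaleK :: "'k::{real_normed_field,banach} \<Rightarrow> 'a::real_normed_vector \<Rightarrow> 'a" +
  fixes S :: "'a set" and \<tau> :: "'a topology"
  assumes subspace_S: "module.subspace scaleK S"
    and complete_S: "complete S"
    and locally_convex: "locally_convex_topology scaleK S \<tau>"
    and Hausdorff: "Hausdorff_space \<tau>"
    and coarser: "openin \<tau> U \<Longrightarrow> openin (top_of_set S) U"
    and seq_complete: "closedin \<tau> C \<Longrightarrow> bounded C \<Longrightarrow> sequentially_complete_in \<tau> C"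
    and norming: "x \<in> S \<Longrightarrow>
      norm x = (SUP \<phi>\<in>{\<phi> \<in> topological_dual scaleK S \<tau>. \<forall>y\<in>S. norm (\<phi> y) \<le> norm y}. norm (\<phi> x))"

text \<open>Only the values \<open>T t x\<close> with \<open>t \<ge> 0\<close> and \<open>x \<in> S\<close> matter.\<close>

locale bi_continuous_semigroup =
  bi_admissible_space scaleK S \<tau>
  for scaleK :: "'k::{real_normed_field,banach} \<Rightarrow> 'a::real_normed_vector \<Rightarrow> 'a"
    and S :: "'a set" and \<tau> :: "'a topology" +
  fixes T :: "real \<Rightarrow> 'a \<Rightarrow> 'a"
  assumes operator: "t \<ge> 0 \<Longrightarrow> bounded_operator_on scaleK S (T t)"
    and zero: "x \<in> S \<Longrightarrow> T 0 x = x"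
    and add: "t \<ge> 0 \<Longrightarrow> s \<ge> 0 \<Longrightarrow> x \<in> S \<Longrightarrow> T (t + s) x = T t (T s x)"
    and orbit_continuous: "x \<in> S \<Longrightarrow> continuous_map (top_of_set {0..}) \<tau> (\<lambda>t. T t x)"
    and locally_bounded: "\<exists>M. \<forall>t\<in>{0..1}. \<forall>x\<in>S. norm (T t x) \<le> M * norm x"
    and locally_bi_equicontinuous:
      "\<lbrakk>range u \<subseteq> S; bounded (range u); limitin \<tau> u 0 sequentially; 0 \<le> a; a \<le> b;
        openin \<tau> U; 0 \<in> U\<rbrakk> \<Longrightarrow> \<forall>\<^sub>F n in sequentially. \<forall>t\<in>{a..b}. T t (u n) \<in> U"

text \<open>
  Functionals on \<open>X\<close> are the \<open>'k\<close>-linear elements of \<^typ>\<open>'a::real_normed_vector \<Rightarrow>\<^sub>L 'k::real_normed_field\<close>,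
  whose norm is the operator norm, and whose \<open>'k\<close>-multiples are pointwise.
\<close>

definition dual_scale ::
  "'k::real_normed_field \<Rightarrow> ('a::real_normed_vector \<Rightarrow>\<^sub>L 'k) \<Rightarrow> ('a \<Rightarrow>\<^sub>L 'k)"
  where "dual_scale c \<phi> = blinfun_mult_right c o\<^sub>L \<phi>"

lemma dual_scale_apply [simp]: "blinfun_apply (dual_scale c \<phi>) x = c * blinfun_apply \<phi> x"
  by (simp add: dual_scale_def)

definition circ_dual ::
  "('k::real_normed_field \<Rightarrow> 'a \<Rightarrow> 'a) \<Rightarrow> 'a::real_normed_vector topology \<Rightarrow> ('a \<Rightarrow>\<^sub>L 'k) set"
  where "circ_dual scaleK \<tau> =
    {\<phi>. linear_map_on scaleK (*) UNIV (blinfun_apply \<phi>) \<and>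
        (\<forall>x l. bounded (range x) \<and> limitin \<tau> x l sequentially
          \<longrightarrow> (\<lambda>n. blinfun_apply \<phi> (x n)) \<longlonglongrightarrow> blinfun_apply \<phi> l)}"

text \<open>
  \<open>\<sigma>(X\<^sup>\<circ>, X)\<close>: the strong operator topology on \<open>'k\<close>-valued maps is that of pointwise convergence.
\<close>

definition circ_topology ::
  "('k::real_normed_field \<Rightarrow> 'a \<Rightarrow> 'a) \<Rightarrow> 'a::real_normed_vector topology \<Rightarrow> ('a \<Rightarrow>\<^sub>L 'k) topology"
  where "circ_topology scaleK \<tau> = subtopology strong_operator_topology (circ_dual scaleK \<tau>)"

definition adjoint_operator ::
  "('a \<Rightarrow>\<^sub>L 'a) \<Rightarrow> ('a::real_normed_vector \<Rightarrow>\<^sub>L 'k::real_normed_field) \<Rightarrow> ('a \<Rightarrow>\<^sub>L 'k)"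
  where "adjoint_operator B \<phi> = \<phi> o\<^sub>L B"

definition equicontinuous_on_bounded ::
  "'a::real_normed_vector topology \<Rightarrow> (nat \<Rightarrow> 'a \<Rightarrow>\<^sub>L 'k::real_normed_field) \<Rightarrow> bool"
  where "equicontinuous_on_bounded \<tau> \<phi> \<longleftrightarrow>
    (\<forall>D. bounded D \<longrightarrow> (\<forall>x\<^sub>0\<in>D. \<forall>\<epsilon>>0. \<exists>U. openin \<tau> U \<and> x\<^sub>0 \<in> U \<and>
      (\<forall>x\<in>U \<inter> D. \<forall>n. norm (blinfun_apply (\<phi> n) x - blinfun_apply (\<phi> n) x\<^sub>0) \<le> \<epsilon>)))"

end

theory Submission
  imports Defs
begin

text \<open>
  Condition (A), rescaled to balls of arbitrary radius, gives sequential completeness of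
  \<open>X\<^sup>\<circ>\<close>, and evaluations at points of the unit ball of \<open>X\<close> are norming for \<open>X\<^sup>\<circ>\<close>. For the
  local bi-equicontinuity, a bounded null sequence \<open>\<phi>\<^sub>n\<close> is \<open>\<tau>\<close>-equicontinuous on
  norm-bounded sets by (B), in particular on the orbit \<open>{T(t)x | a \<le> t \<le> b}\<close>. This orbit is
  \<open>\<tau>\<close>-compact and norm-bounded, so pointwise convergence of \<open>\<phi>\<^sub>n\<close> is uniform on it.
\<close>

section \<open>The strong operator topology\<close>

text \<open>The topology is pulled back from the product topology, so a neighbourhood of zero
  restricts only finitely many coordinates. Each restriction contains a ball around zero, and the
  smallest radius serves for all of them. This later turns a statement about neighbourhoods into one
  about finitely many points.\<close>

lemma strong_operator_topology_nbhd:
  fixes U :: "('a::real_normed_vector \<Rightarrow>\<^sub>L 'b::real_normed_vector) set"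
  assumes "openin strong_operator_topology U" "0 \<in> U"
  obtains F \<epsilon> where "finite F" "\<epsilon> > 0" "{\<phi>. \<forall>x\<in>F. norm (blinfun_apply \<phi> x) < \<epsilon>} \<subseteq> U"
proof -
  obtain W :: "('a \<Rightarrow> 'b) set" where W: "open W" "U = blinfun_apply -` W"
    using assms(1) by (auto simp: strong_operator_topology_def openin_pullback_topology)
  then have "openin (product_topology (\<lambda>_. euclidean) UNIV) W"
    by (simp add: euclidean_product_topology)
  moreover have "blinfun_apply 0 \<in> W"
    using assms(2) W(2) by auto
  ultimately obtain V where V: "finite {i. V i \<noteq> UNIV}" "\<And>i. open (V i)"
      "\<And>i. blinfun_apply (0 :: 'a \<Rightarrow>\<^sub>L 'b) i \<in> V i" "\<And>f. (\<And>i. f i \<in> V i) \<Longrightarrow> f \<in> W"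
    unfolding openin_product_topology_alt
    by (fastforce simp: PiE_iff subset_iff)
  have "\<exists>e>0. \<forall>y. norm y < e \<longrightarrow> y \<in> V i" for i
  proof -
    obtain e where "e > 0" "ball 0 e \<subseteq> V i"
      using openE[OF V(2)[of i], of 0] V(3)[of i] by auto
    then show ?thesis by (auto simp: subset_iff)
  qed
  then obtain e where e: "\<And>i. e i > 0" "\<And>i y. norm y < e i \<Longrightarrow> y \<in> V i"
    by metis
  show thesis
  proof
    let ?F = "{i. V i \<noteq> UNIV}"
    show "finite ?F" by (rule V(1))
    \<comment> \<open>The inserted 1 keeps the minimum defined when no coordinate is
      restricted.\<close>
    show "Min (insert 1 (e ` ?F)) > 0"
      using V(1) e(1) by simp
    show "{\<phi>. \<forall>x\<in>?F. norm (blinfun_apply \<phi> x) < Min (insert 1 (e ` ?F))} \<subseteq> U"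
    proof clarify
      fix \<phi> :: "'a \<Rightarrow>\<^sub>L 'b"
      assume *: "\<forall>x\<in>?F. norm (blinfun_apply \<phi> x) < Min (insert 1 (e ` ?F))"
      have "blinfun_apply \<phi> i \<in> V i" for i
      proof (cases "i \<in> ?F")
        case True
        then have "norm (blinfun_apply \<phi> i) < Min (insert 1 (e ` ?F))"
          using * by blast
        also have "\<dots> \<le> e i"
          using True V(1) by (intro Min_le) auto
        finally show ?thesis by (rule e(2))
      qed auto
      then show "\<phi> \<in> U"
        using V(4) W(2) by auto
    qed
  qed
qed

lemma openin_strong_operator_topology_seminorms:
  assumes "finite F"
  shows "openin strong_operator_topology {\<phi>. \<forall>x\<in>F. norm (blinfun_apply \<phi> x) < \<epsilon>}"
  using strong_operator_topology_basis[of F "\<lambda>_. ball 0 \<epsilon>" "\<lambda>x. x"] assms by simp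

lemma convex_blinfun_seminorms:
  fixes F :: "'a::real_normed_vector set"
  shows "convex {\<phi> :: 'a \<Rightarrow>\<^sub>L 'b::real_normed_vector. \<forall>x\<in>F. norm (blinfun_apply \<phi> x) < \<epsilon>}"
proof -
  have "convex ((\<lambda>\<phi> :: 'a \<Rightarrow>\<^sub>L 'b. blinfun_apply \<phi> x) -` ball 0 \<epsilon>)" for x
    by (intro convex_linear_vimage bounded_linear.linear blinfun.bounded_linear_left convex_ball)
  then have "convex (\<Inter>x\<in>F. (\<lambda>\<phi> :: 'a \<Rightarrow>\<^sub>L 'b. blinfun_apply \<phi> x) -` ball 0 \<epsilon>)"
    by (blast intro: convex_Inter)
  moreover have "(\<Inter>x\<in>F. (\<lambda>\<phi> :: 'a \<Rightarrow>\<^sub>L 'b. blinfun_apply \<phi> x) -` ball 0 \<epsilon>)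
      = {\<phi>. \<forall>x\<in>F. norm (blinfun_apply \<phi> x) < \<epsilon>}"
    by auto
  ultimately show ?thesis by simp
qed

lemma Hausdorff_strong_operator_topology:
  "Hausdorff_space (strong_operator_topology ::
     ('a::real_normed_vector \<Rightarrow>\<^sub>L 'b::real_normed_vector) topology)"
  unfolding Hausdorff_space_def
proof clarify
  fix \<phi> \<psi> :: "'a \<Rightarrow>\<^sub>L 'b"
  assume "\<phi> \<noteq> \<psi>"
  then obtain x where "blinfun_apply \<phi> x \<noteq> blinfun_apply \<psi> x"
    using blinfun_eqI by blast
  then obtain A B where AB: "open A" "open B" "blinfun_apply \<phi> x \<in> A" "blinfun_apply \<psi> x \<in> B"
      "A \<inter> B = {}"
    by (meson separation_t2)
  have op: "openin strong_operator_topology {\<phi> :: 'a \<Rightarrow>\<^sub>L 'b. blinfun_apply \<phi> x \<in> C}"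
    if "open C" for C
    using strong_operator_topology_basis[of "{x}" "\<lambda>_. C" "\<lambda>x. x"] that by simp
  show "\<exists>U V. openin strong_operator_topology U \<and> openin strong_operator_topology V \<and>
      \<phi> \<in> U \<and> \<psi> \<in> V \<and> disjnt U V"
    using AB op[OF AB(1)] op[OF AB(2)]
    by (intro exI[of _ "{\<phi>. blinfun_apply \<phi> x \<in> A}"] exI[of _ "{\<phi>. blinfun_apply \<phi> x \<in> B}"])
      (auto simp: disjnt_def)
qed

lemma openin_strong_operator_topology_imp_open:
  "openin strong_operator_topology U \<Longrightarrow> open U"
  using strong_operator_topology_weaker_than_euclidean
  by (force simp: continuous_map_def)

text \<open>Multiplication is jointly continuous on pairs of scalars, and it is composed with the
  pairing of \<open>f\<close> and \<open>g\<close>.\<close>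

lemma continuous_map_mult_field:
  fixes f g :: "'c \<Rightarrow> 'k::real_normed_field"
  assumes "continuous_map X euclidean f" "continuous_map X euclidean g"
  shows "continuous_map X euclidean (\<lambda>x. f x * g x)"
proof -
  have "continuous_map X euclidean (\<lambda>x. (f x, g x))"
    using assms continuous_map_paired[of X euclidean euclidean f g] by simp
  moreover have "continuous_on UNIV (\<lambda>z :: 'k \<times> 'k. fst z * snd z)"
    by (intro continuous_intros)
  then have "continuous_map euclidean euclidean (\<lambda>z :: 'k \<times> 'k. fst z * snd z)"
    by simp
  ultimately have "continuous_map X euclidean ((\<lambda>z. fst z * snd z) \<circ> (\<lambda>x. (f x, g x)))"
    by (rule continuous_map_compose)
  then show ?thesis by (simp add: o_def)
qed

text \<open>By homogeneity a nonzero vector may be normalised. In this form evaluations on the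
  closed unit ball control the dual norm, which is what the norming condition needs.\<close>

lemma norm_blinfun_le_cball:
  fixes \<phi> :: "'a::real_normed_vector \<Rightarrow>\<^sub>L 'b::real_normed_vector"
  assumes "\<And>x. norm x \<le> 1 \<Longrightarrow> norm (blinfun_apply \<phi> x) \<le> c"
  shows "norm \<phi> \<le> c"
proof (rule norm_blinfun_bound)
  show "0 \<le> c" using assms[of 0] by simp
  fix x
  have "norm (blinfun_apply \<phi> x) \<le> c * norm x" if "x \<noteq> 0"
  proof -
    have "norm (blinfun_apply \<phi> (x /\<^sub>R norm x)) \<le> c"
      using that by (intro assms) simp
    then show ?thesis
      using that by (simp add: blinfun.scaleR_right divide_simps mult.commute)
  qed
  then show "norm (blinfun_apply \<phi> x) \<le> c * norm x" by (cases "x = 0") auto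
qed

section \<open>The dual space\<close>

lemma dual_scale_of_real: "dual_scale (of_real r) \<phi> = r *\<^sub>R \<phi>"
  by (rule blinfun_eqI) (simp add: blinfun.scaleR_left scaleR_conv_of_real)

lemma norm_dual_scale_le: "norm (dual_scale c \<phi>) \<le> norm c * norm \<phi>"
proof (rule norm_blinfun_bound)
  fix x
  show "norm (blinfun_apply (dual_scale c \<phi>) x) \<le> norm c * norm \<phi> * norm x"
    using mult_left_mono[OF norm_blinfun[of \<phi> x] norm_ge_zero[of c]]
    by (simp add: norm_mult mult.assoc)
qed simp

lemma norm_dual_scale: "norm (dual_scale c \<phi>) = norm c * norm \<phi>"
proof (cases "c = 0")
  case False
  \<comment> \<open>Undoing the scaling lets the upper estimate, applied to
    \<open>inverse c\<close>, supply the reverse inequality.\<close>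
  have "\<phi> = dual_scale (inverse c) (dual_scale c \<phi>)"
    using False by (intro blinfun_eqI) simp
  then have "norm \<phi> \<le> inverse (norm c) * norm (dual_scale c \<phi>)"
    by (metis norm_dual_scale_le norm_inverse)
  then have "norm c * norm \<phi> \<le> norm (dual_scale c \<phi>)"
    using False by (simp add: field_simps)
  then show ?thesis
    using norm_dual_scale_le by (intro antisym)
next
  case True
  then show ?thesis using norm_dual_scale_le[of c \<phi>] by simp
qed

lemma normed_space_over_dual:
  "normed_space_over
    (dual_scale :: 'k::{real_normed_field,banach} \<Rightarrow> ('a::real_normed_vector \<Rightarrow>\<^sub>L 'k) \<Rightarrow> _)"
  by unfold_locales
    (auto intro!: blinfun_eqI norm_dual_scale dual_scale_of_real
      simp: blinfun.add_left algebra_simps)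

section \<open>The space of sequentially continuous functionals\<close>

lemma circ_dualD:
  assumes "\<phi> \<in> circ_dual scaleK \<tau>"
  shows "blinfun_apply \<phi> (scaleK c x) = c * blinfun_apply \<phi> x"
    and "bounded (range u) \<Longrightarrow> limitin \<tau> u l sequentially
      \<Longrightarrow> (\<lambda>n. blinfun_apply \<phi> (u n)) \<longlonglongrightarrow> blinfun_apply \<phi> l"
  using assms by (auto simp: circ_dual_def linear_map_on_def)

text \<open>Additivity is already part of being a bounded linear map, so only homogeneity over
  \<open>'k\<close> and sequential continuity remain to be checked.\<close>

lemma circ_dualI:
  assumes "\<And>c x. blinfun_apply \<phi> (scaleK c x) = c * blinfun_apply \<phi> x"
    and "\<And>u l. bounded (range u) \<Longrightarrow> limitin \<tau> u l sequentially
      \<Longrightarrow> (\<lambda>n. blinfun_apply \<phi> (u n)) \<longlonglongrightarrow> blinfun_apply \<phi> l"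
  shows "\<phi> \<in> circ_dual scaleK \<tau>"
  using assms by (auto simp: circ_dual_def linear_map_on_def blinfun.add_right)

lemma zero_in_circ_dual: "0 \<in> circ_dual scaleK \<tau>"
  by (rule circ_dualI) auto

lemma add_in_circ_dual:
  "\<phi> \<in> circ_dual scaleK \<tau> \<Longrightarrow> \<psi> \<in> circ_dual scaleK \<tau> \<Longrightarrow> \<phi> + \<psi> \<in> circ_dual scaleK \<tau>"
  by (rule circ_dualI)
    (auto simp: blinfun.add_left circ_dualD(1) algebra_simps intro!: tendsto_add circ_dualD(2))

lemma dual_scale_in_circ_dual:
  "\<phi> \<in> circ_dual scaleK \<tau> \<Longrightarrow> dual_scale c \<phi> \<in> circ_dual scaleK \<tau>"
  by (rule circ_dualI) (auto simp: circ_dualD(1) intro!: tendsto_mult circ_dualD(2))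

lemma scaleR_in_circ_dual:
  "\<phi> \<in> circ_dual scaleK \<tau> \<Longrightarrow> r *\<^sub>R \<phi> \<in> circ_dual scaleK \<tau>"
  using dual_scale_in_circ_dual[of \<phi> scaleK \<tau> "of_real r"] by (simp add: dual_scale_of_real)

text \<open>Norm convergence of functionals is uniform on bounded sets. Along a bounded
  \<open>\<tau>\<close>-convergent sequence the two limits may therefore be interchanged, and
  sequential continuity passes to the limit.\<close>

lemma closed_circ_dual:
  fixes scaleK :: "'k::real_normed_field \<Rightarrow> 'a::real_normed_vector \<Rightarrow> 'a"
  shows "closed (circ_dual scaleK \<tau>)"
  unfolding closed_sequential_limits
proof clarify
  fix \<phi> \<psi> assume \<phi>: "\<forall>n. \<phi> n \<in> circ_dual scaleK \<tau>" and lim: "\<phi> \<longlonglongrightarrow> \<psi>"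
  have pt: "(\<lambda>n. blinfun_apply (\<phi> n) x) \<longlonglongrightarrow> blinfun_apply \<psi> x" for x
    using lim by (intro tendsto_intros)
  show "\<psi> \<in> circ_dual scaleK \<tau>"
  proof (rule circ_dualI)
    fix c x
    \<comment> \<open>This sequence also tends to \<open>c * blinfun_apply \<psi> x\<close>, so
      uniqueness of limits gives homogeneity.\<close>
    have "(\<lambda>n. c * blinfun_apply (\<phi> n) x) \<longlonglongrightarrow> blinfun_apply \<psi> (scaleK c x)"
      using pt[of "scaleK c x"] \<phi> by (simp add: circ_dualD(1)[of _ scaleK \<tau>])
    then show "blinfun_apply \<psi> (scaleK c x) = c * blinfun_apply \<psi> x"
      using LIMSEQ_unique tendsto_mult_left[OF pt] by blast
  next
    fix u l assume u: "bounded (range u)" "limitin \<tau> u l sequentially"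
    obtain K where K: "K > 0" "\<And>n. norm (u n) \<le> K"
      using u(1) by (auto simp: bounded_pos)
    show "(\<lambda>n. blinfun_apply \<psi> (u n)) \<longlonglongrightarrow> blinfun_apply \<psi> l"
    proof (rule swap_uniform_limit'[where f = "\<lambda>m n. blinfun_apply (\<phi> m) (u n)"
          and g = "\<lambda>m. blinfun_apply (\<phi> m) l" and S = UNIV])
      show "\<forall>\<^sub>F m in sequentially. (\<lambda>n. blinfun_apply (\<phi> m) (u n)) \<longlonglongrightarrow> blinfun_apply (\<phi> m) l"
        using \<phi> u by (simp add: circ_dualD(2)[of _ scaleK \<tau>])
      show "(\<lambda>m. blinfun_apply (\<phi> m) l) \<longlonglongrightarrow> blinfun_apply \<psi> l" by (rule pt)
      show "uniform_limit UNIV (\<lambda>m n. blinfun_apply (\<phi> m) (u n)) (\<lambda>n. blinfun_apply \<psi> (u n))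
          sequentially"
      proof (rule uniform_limitI)
        fix e :: real assume "e > 0"
        \<comment> \<open>Division by the bound \<open>K\<close> of the sequence \<open>u\<close>
          makes the estimate below independent of \<open>n\<close>.\<close>
        then have "\<forall>\<^sub>F m in sequentially. dist (\<phi> m) \<psi> < e / K"
          using lim K(1) by (intro tendstoD) simp_all
        then show "\<forall>\<^sub>F m in sequentially. \<forall>n\<in>UNIV.
            dist (blinfun_apply (\<phi> m) (u n)) (blinfun_apply \<psi> (u n)) < e"
        proof eventually_elim
          case (elim m)
          show ?case
          proof
            fix n
            have "norm (blinfun_apply (\<phi> m - \<psi>) (u n)) \<le> norm (\<phi> m - \<psi>) * norm (u n)"
              by (rule norm_blinfun)
            also have "\<dots> \<le> norm (\<phi> m - \<psi>) * K"
              by (intro mult_left_mono K) simp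
            also have "\<dots> < e"
              using elim K(1) by (simp add: dist_norm field_simps)
            finally show "dist (blinfun_apply (\<phi> m) (u n)) (blinfun_apply \<psi> (u n)) < e"
              by (simp add: dist_norm blinfun.diff_left)
          qed
        qed
      qed
    qed simp_all
  qed
qed

section \<open>The weak topology \<open>circ_topology\<close> and conditions (i)--(iii) for
  \<open>circ_dual\<close>\<close>

lemma topspace_circ_topology [simp]: "topspace (circ_topology scaleK \<tau>) = circ_dual scaleK \<tau>"
  by (simp add: circ_topology_def strong_operator_topology_topspace)

lemma continuous_map_circ_topology_eval:
  "continuous_map (circ_topology scaleK \<tau>) euclidean (\<lambda>\<phi>. blinfun_apply \<phi> x)"
  unfolding circ_topology_def
  by (intro continuous_map_from_subtopology strong_operator_topology_continuous_evaluation)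

text \<open>This is the universal property of the initial topology for the evaluations: continuity
  into the dual side becomes continuity of scalar functions.\<close>

lemma continuous_map_into_circ_topology:
  assumes "\<And>z. z \<in> topspace X \<Longrightarrow> f z \<in> circ_dual scaleK \<tau>"
    and "\<And>x. continuous_map X euclidean (\<lambda>z. blinfun_apply (f z) x)"
  shows "continuous_map X (circ_topology scaleK \<tau>) f"
  unfolding circ_topology_def continuous_map_in_subtopology
    continuous_on_strong_operator_topo_iff_coordinatewise
  using assms by auto

lemma circ_topology_nbhd:
  assumes "openin (circ_topology scaleK \<tau>) U" "0 \<in> U"
  obtains F \<epsilon> where "finite F" "\<epsilon> > 0"
    "{\<phi> \<in> circ_dual scaleK \<tau>. \<forall>x\<in>F. norm (blinfun_apply \<phi> x) < \<epsilon>} \<subseteq> U"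
proof -
  obtain V where V: "openin strong_operator_topology V" "U = V \<inter> circ_dual scaleK \<tau>"
    using assms(1) by (auto simp: circ_topology_def openin_subtopology)
  then have "0 \<in> V" using assms(2) by blast
  with V(1) obtain F \<epsilon> where "finite F" "\<epsilon> > 0"
      "{\<phi>. \<forall>x\<in>F. norm (blinfun_apply \<phi> x) < \<epsilon>} \<subseteq> V"
    by (rule strong_operator_topology_nbhd)
  then show thesis
    using V(2) by (intro that[of F \<epsilon>]) auto
qed

lemma continuous_map_circ_topology_scaleR:
  "continuous_map (circ_topology scaleK \<tau>) (circ_topology scaleK \<tau>) (\<lambda>\<phi>. r *\<^sub>R \<phi>)"
  by (rule continuous_map_into_circ_topology)
    (auto simp: scaleR_in_circ_dual blinfun.scaleR_left scaleR_conv_of_real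
      intro!: continuous_map_mult_field continuous_map_circ_topology_eval)

lemma subspace_circ_dual:
  fixes scaleK :: "'k::{real_normed_field,banach} \<Rightarrow> 'a::real_normed_vector \<Rightarrow> 'a"
  shows "module.subspace dual_scale (circ_dual scaleK \<tau>)"
proof -
  interpret normed_space_over "dual_scale :: 'k \<Rightarrow> ('a \<Rightarrow>\<^sub>L 'k) \<Rightarrow> _"
    by (rule normed_space_over_dual)
  show ?thesis
    by (simp add: subspace_def zero_in_circ_dual add_in_circ_dual dual_scale_in_circ_dual)
qed

text \<open>Continuity of the vector space operations is checked after evaluation at each point.
  Convex neighbourhoods come from finitely many evaluation seminorms.\<close>

lemma locally_convex_circ_topology:
  "locally_convex_topology dual_scale (circ_dual scaleK \<tau>) (circ_topology scaleK \<tau>)"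
  unfolding locally_convex_topology_def
proof (intro conjI allI impI)
  let ?c = "circ_topology scaleK \<tau>"
  have ev: "continuous_map (prod_topology X ?c) euclidean (\<lambda>z. blinfun_apply (snd z) x)"
    "continuous_map (prod_topology ?c X) euclidean (\<lambda>z. blinfun_apply (fst z) x)"
    for x and X :: "'c topology"
    using continuous_map_compose[OF continuous_map_snd[of X ?c] continuous_map_circ_topology_eval]
      continuous_map_compose[OF continuous_map_fst[of ?c X] continuous_map_circ_topology_eval]
    by (simp_all add: o_def)
  show "continuous_map (prod_topology ?c ?c) ?c (\<lambda>(x, y). x + y)"
    unfolding case_prod_beta
    by (rule continuous_map_into_circ_topology)
      (auto simp: blinfun.add_left add_in_circ_dual intro!: continuous_map_add ev)
  show "continuous_map (prod_topology euclidean ?c) ?c (\<lambda>(c, x). dual_scale c x)"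
    unfolding case_prod_beta
    by (rule continuous_map_into_circ_topology)
      (auto simp: dual_scale_in_circ_dual intro!: continuous_map_mult_field ev continuous_map_fst)
  fix U assume "openin ?c U \<and> 0 \<in> U"
  then have "openin ?c U" "0 \<in> U" by auto
  then obtain F \<epsilon> where F: "finite F" "\<epsilon> > 0"
      "{\<phi> \<in> circ_dual scaleK \<tau>. \<forall>x\<in>F. norm (blinfun_apply \<phi> x) < \<epsilon>} \<subseteq> U"
    by (rule circ_topology_nbhd)
  let ?V = "{\<phi>. \<forall>x\<in>F. norm (blinfun_apply \<phi> x) < \<epsilon>} \<inter> circ_dual scaleK \<tau>"
  have "openin ?c ?V"
    unfolding circ_topology_def
    by (intro openin_subtopology_Int openin_strong_operator_topology_seminorms F)
  moreover have "convex (circ_dual scaleK \<tau>)"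
    by (simp add: convex_def add_in_circ_dual scaleR_in_circ_dual)
  then have "convex ?V"
    by (intro convex_Int convex_blinfun_seminorms)
  moreover have "0 \<in> ?V" "?V \<subseteq> U"
    using F by (auto simp: zero_in_circ_dual)
  ultimately show "\<exists>V. openin ?c V \<and> convex V \<and> 0 \<in> V \<and> V \<subseteq> U" by blast
qed simp

text \<open>A bounded set lies in some ball of radius \<open>R\<close>. Dividing by \<open>R\<close>
  moves a Cauchy sequence into the unit ball, where (A) gives a limit; multiplying by
  \<open>R\<close> moves the limit back, and closedness keeps it in \<open>C\<close>.\<close>

lemma sequentially_complete_in_circ_topology:
  assumes A: "sequentially_complete_in (circ_topology scaleK \<tau>) (circ_dual scaleK \<tau> \<inter> cball 0 1)"
    and C: "closedin (circ_topology scaleK \<tau>) C" "bounded C"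
  shows "sequentially_complete_in (circ_topology scaleK \<tau>) C"
  unfolding sequentially_complete_in_def
proof (intro allI impI; elim conjE)
  let ?c = "circ_topology scaleK \<tau>"
  fix \<phi> assume \<phi>: "range \<phi> \<subseteq> C" "topological_Cauchy ?c \<phi>"
  obtain R where R: "R > 0" "\<And>\<psi>. \<psi> \<in> C \<Longrightarrow> norm \<psi> \<le> R"
    using C(2) by (auto simp: bounded_pos)
  have circ: "C \<subseteq> circ_dual scaleK \<tau>"
    using closedin_subset[OF C(1)] by simp
  have "range (\<lambda>n. inverse R *\<^sub>R \<phi> n) \<subseteq> circ_dual scaleK \<tau> \<inter> cball 0 1"
    using \<phi>(1) R circ by (auto simp: image_subset_iff field_simps intro!: scaleR_in_circ_dual)
  moreover have "topological_Cauchy ?c (\<lambda>n. inverse R *\<^sub>R \<phi> n)"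
    unfolding topological_Cauchy_def
  proof (intro allI impI; elim conjE)
    fix U assume U: "openin ?c U" "0 \<in> U"
    \<comment> \<open>The Cauchy property of the original sequence is applied to the preimage of
      \<open>U\<close> under scaling, which is again a neighbourhood of zero.\<close>
    have "openin ?c {\<psi> \<in> topspace ?c. inverse R *\<^sub>R \<psi> \<in> U}"
      by (rule openin_continuous_map_preimage[OF continuous_map_circ_topology_scaleR U(1)])
    moreover have "0 \<in> {\<psi> \<in> topspace ?c. inverse R *\<^sub>R \<psi> \<in> U}"
      using U(2) by (simp add: zero_in_circ_dual)
    ultimately have "\<exists>N. \<forall>m\<ge>N. \<forall>n\<ge>N. \<phi> m - \<phi> n \<in> {\<psi> \<in> topspace ?c. inverse R *\<^sub>R \<psi> \<in> U}"
      using \<phi>(2) unfolding topological_Cauchy_def by blast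
    then show "\<exists>N. \<forall>m\<ge>N. \<forall>n\<ge>N. inverse R *\<^sub>R \<phi> m - inverse R *\<^sub>R \<phi> n \<in> U"
      by (auto simp: scaleR_diff_right)
  qed
  ultimately obtain l where l: "limitin ?c (\<lambda>n. inverse R *\<^sub>R \<phi> n) l sequentially"
    using A unfolding sequentially_complete_in_def by blast
  have "limitin ?c \<phi> (R *\<^sub>R l) sequentially"
    using continuous_map_limit[OF continuous_map_circ_topology_scaleR[of scaleK \<tau> R] l] R(1)
    by (simp add: o_def)
  moreover from this have "R *\<^sub>R l \<in> C"
    using \<phi>(1)
    by (intro limitin_closedin[OF _ C(1)] always_eventually) (auto simp: image_subset_iff)
  ultimately show "\<exists>l\<in>C. limitin ?c \<phi> l sequentially" by blast
qed

text \<open>The dual norm is the supremum over evaluations at points of the unit ball. These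
  evaluations are continuous for \<open>circ_topology\<close> and belong to the index set, whose
  other members cannot exceed \<open>norm \<phi>\<close>.\<close>

lemma norm_eq_SUP_circ_dual:
  fixes scaleK :: "'k::{real_normed_field,banach} \<Rightarrow> 'a::real_normed_vector \<Rightarrow> 'a"
  assumes "\<phi> \<in> circ_dual scaleK \<tau>"
  shows "norm \<phi> = (SUP \<Phi>\<in>{\<Phi> \<in> topological_dual dual_scale (circ_dual scaleK \<tau>) (circ_topology scaleK \<tau>).
    \<forall>\<psi>\<in>circ_dual scaleK \<tau>. norm (\<Phi> \<psi>) \<le> norm \<psi>}. norm (\<Phi> \<phi>))"
    (is "_ = (SUP \<Phi>\<in>?D. _)")
proof -
  have ev: "(\<lambda>\<psi>. blinfun_apply \<psi> x) \<in> ?D" if "norm x \<le> 1" for x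
  proof -
    have "norm (blinfun_apply \<psi> x) \<le> norm \<psi>" for \<psi> :: "'a \<Rightarrow>\<^sub>L 'k"
      using norm_blinfun[of \<psi> x] mult_left_mono[OF that, of "norm \<psi>"] by simp
    then show ?thesis
      by (simp add: topological_dual_def linear_map_on_def blinfun.add_left
          continuous_map_circ_topology_eval)
  qed
  \<comment> \<open>The constraint in \<open>?D\<close>, taken at \<open>\<phi>\<close> itself,
    provides the upper bound.\<close>
  have bdd: "bdd_above ((\<lambda>\<Phi>. norm (\<Phi> \<phi>)) ` ?D)"
    using assms by (intro bdd_aboveI2[of _ _ "norm \<phi>"]) blast
  show ?thesis
  proof (rule antisym)
    show "norm \<phi> \<le> (SUP \<Phi>\<in>?D. norm (\<Phi> \<phi>))"
      by (rule norm_blinfun_le_cball) (rule cSUP_upper[OF ev bdd])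
    show "(SUP \<Phi>\<in>?D. norm (\<Phi> \<phi>)) \<le> norm \<phi>"
      \<comment> \<open>Evaluation at 0 shows that the index set is nonempty.\<close>
      using assms ev[of 0] by (intro cSUP_least) auto
  qed
qed

lemma bi_admissible_space_circ_dual:
  fixes scaleK :: "'k::{real_normed_field,banach} \<Rightarrow> 'a::real_normed_vector \<Rightarrow> 'a"
  assumes "sequentially_complete_in (circ_topology scaleK \<tau>) (circ_dual scaleK \<tau> \<inter> cball 0 1)"
  shows "bi_admissible_space dual_scale (circ_dual scaleK \<tau>) (circ_topology scaleK \<tau>)"
proof -
  interpret normed_space_over "dual_scale :: 'k \<Rightarrow> ('a \<Rightarrow>\<^sub>L 'k) \<Rightarrow> _"
    by (rule normed_space_over_dual)
  show ?thesis
  proof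
    show "subspace (circ_dual scaleK \<tau>)"
      by (rule subspace_circ_dual)
    show "complete (circ_dual scaleK \<tau>)"
      by (simp add: complete_eq_closed closed_circ_dual)
    show "locally_convex_topology dual_scale (circ_dual scaleK \<tau>) (circ_topology scaleK \<tau>)"
      by (rule locally_convex_circ_topology)
    show "Hausdorff_space (circ_topology scaleK \<tau>)"
      unfolding circ_topology_def
      by (intro Hausdorff_space_subtopology Hausdorff_strong_operator_topology)
    show "openin (top_of_set (circ_dual scaleK \<tau>)) U" if "openin (circ_topology scaleK \<tau>) U" for U
      using that openin_strong_operator_topology_imp_open
      by (fastforce simp: circ_topology_def openin_subtopology)
  qed (use assms in \<open>auto intro: sequentially_complete_in_circ_topology norm_eq_SUP_circ_dual\<close>)
qed

section \<open>The adjoint semigroup\<close>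

context bi_continuous_semigroup
begin

text \<open>Splitting off one unit of time at each step multiplies the bound by a constant, so a
  bound \<open>K\<close> on [0,1] yields \<open>K ^ n\<close> on [0,n].\<close>

lemma bounded_on_interval:
  obtains M where "M \<ge> 0" "\<And>t x. 0 \<le> t \<Longrightarrow> t \<le> b \<Longrightarrow> x \<in> S \<Longrightarrow> norm (T t x) \<le> M * norm x"
proof -
  obtain M\<^sub>1 where M\<^sub>1: "\<And>t x. t \<in> {0..1} \<Longrightarrow> x \<in> S \<Longrightarrow> norm (T t x) \<le> M\<^sub>1 * norm x"
    using locally_bounded by blast
  \<comment> \<open>Being at least 1, \<open>K\<close> has increasing powers, so the bound for short
    times is dominated by every \<open>K ^ Suc n\<close>.\<close>
  define K where "K = max 1 M\<^sub>1"
  have K: "norm (T t x) \<le> K * norm x" if "0 \<le> t" "t \<le> 1" "x \<in> S" for t x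
    using M\<^sub>1[of t x] mult_right_mono[of M\<^sub>1 K "norm x"] that by (simp add: K_def)
  have K1: "K \<ge> 1" by (simp add: K_def)
  have "\<forall>t\<in>{0..real n}. \<forall>x\<in>S. norm (T t x) \<le> K ^ n * norm x" for n
  proof (induction n)
    case 0
    then show ?case by (auto simp: zero)
  next
    case (Suc n)
    show ?case
    proof (intro ballI)
      fix t x assume t: "t \<in> {0..real (Suc n)}" and x: "x \<in> S"
      show "norm (T t x) \<le> K ^ Suc n * norm x"
      proof (cases "t \<le> 1")
        case True
        have "K \<le> K ^ Suc n"
          using K1 power_increasing[of 1 "Suc n" K] by simp
        then show ?thesis
          using K[of t x] True t x mult_right_mono[of K "K ^ Suc n" "norm x"] by simp
      next
        case False
        have "T (t - 1) x \<in> S"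
          using operator[of "t - 1"] False x by (auto simp: bounded_operator_on_def)
        have "norm (T t x) = norm (T 1 (T (t - 1) x))"
          using add[of 1 "t - 1" x] False x by simp
        also have "\<dots> \<le> K * norm (T (t - 1) x)"
          using K[of 1] \<open>T (t - 1) x \<in> S\<close> by simp
        also have "\<dots> \<le> K * (K ^ n * norm x)"
          using Suc.IH False t x K1 by (intro mult_left_mono) auto
        finally show ?thesis by (simp add: mult.assoc)
      qed
    qed
  qed
  moreover obtain n where "b \<le> real n"
    using real_arch_simple by blast
  ultimately show thesis
    using K1 by (intro that[of "K ^ n"]) auto
qed

lemma bounded_orbit:
  assumes "x \<in> S"
  shows "bounded ((\<lambda>t. T t x) ` {0..b})"
  using assms by (rule_tac bounded_on_interval[of b]) (force simp: bounded_iff)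

end

section \<open>Semigroups on the whole space and their adjoints\<close>

lemma limitin_diff_locally_convex:
  fixes \<tau> :: "'a::real_vector topology"
  assumes lc: "locally_convex_topology scaleK UNIV \<tau>" and u: "limitin \<tau> u l F"
  shows "limitin \<tau> (\<lambda>n. u n - m) (l - m) F"
proof -
  have top: "topspace \<tau> = UNIV"
    and plus: "continuous_map (prod_topology \<tau> \<tau>) \<tau> (\<lambda>(x, y). x + y)"
    using lc by (auto simp: locally_convex_topology_def)
  have "continuous_map \<tau> (prod_topology \<tau> \<tau>) (\<lambda>x. (x, - m))"
    using top by (auto simp: continuous_map_paired)
  then have "continuous_map \<tau> \<tau> (\<lambda>x. x - m)"
    using continuous_map_compose[OF _ plus, of \<tau> "\<lambda>x. (x, - m)"] by (simp add: o_def)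
  from continuous_map_limit[OF this u] show ?thesis
    by (simp add: o_def)
qed

text \<open>Each operator is a bounded linear map on the whole type, so it can be composed with
  functionals to form its adjoint and has an operator norm.\<close>

locale bi_continuous_semigroup_UNIV =
  bi_continuous_semigroup scaleK UNIV \<tau> "\<lambda>t. blinfun_apply (T t)"
  for scaleK :: "'k::{real_normed_field,banach} \<Rightarrow> 'a::real_normed_vector \<Rightarrow> 'a"
    and \<tau> :: "'a topology" and T :: "real \<Rightarrow> 'a \<Rightarrow>\<^sub>L 'a"
begin

text \<open>Subtracting the limit reduces the claim to null sequences, where local bi-equicontinuity
  on the one-point interval from \<open>t\<close> to \<open>t\<close> applies. Linearity then
  restores the limit.\<close>

lemma limitin_semigroup:
  assumes "t \<ge> 0" "bounded (range u)" "limitin \<tau> u l sequentially"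
  shows "limitin \<tau> (\<lambda>n. blinfun_apply (T t) (u n)) (blinfun_apply (T t) l) sequentially"
proof -
  have "bounded (range (\<lambda>n. u n - l))"
    using assms(2) bounded_minus_comp[of u UNIV "\<lambda>_. l"] by simp
  moreover have "limitin \<tau> (\<lambda>n. u n - l) 0 sequentially"
    using limitin_diff_locally_convex[OF locally_convex assms(3), of l] by simp
  ultimately have "limitin \<tau> (\<lambda>n. blinfun_apply (T t) (u n - l)) 0 sequentially"
    using locally_bi_equicontinuous[of "\<lambda>n. u n - l" t t] assms(1) locally_convex
    by (auto simp: limitin_def locally_convex_topology_def)
  from limitin_diff_locally_convex[OF locally_convex this, of "- blinfun_apply (T t) l"]
  show ?thesis by (simp add: blinfun.diff_right)
qed

text \<open>The operator \<open>T t\<close> sends bounded \<open>\<tau>\<close>-convergent sequences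
  to sequences of the same kind, on which \<open>\<phi>\<close> is continuous.\<close>

lemma adjoint_in_circ_dual:
  assumes "t \<ge> 0" "\<phi> \<in> circ_dual scaleK \<tau>"
  shows "adjoint_operator (T t) \<phi> \<in> circ_dual scaleK \<tau>"
proof (rule circ_dualI)
  fix c x
  show "blinfun_apply (adjoint_operator (T t) \<phi>) (scaleK c x) =
      c * blinfun_apply (adjoint_operator (T t) \<phi>) x"
    using operator[OF assms(1)]
    by (simp add: adjoint_operator_def bounded_operator_on_def linear_map_on_def
        circ_dualD(1)[OF assms(2)])
next
  fix u l assume u: "bounded (range u)" "limitin \<tau> u l sequentially"
  have "bounded (range (\<lambda>n. blinfun_apply (T t) (u n)))"
    using bounded_linear_image[OF u(1) blinfun.bounded_linear_right[of "T t"]]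
    by (simp add: image_image)
  then show "(\<lambda>n. blinfun_apply (adjoint_operator (T t) \<phi>) (u n))
      \<longlonglongrightarrow> blinfun_apply (adjoint_operator (T t) \<phi>) l"
    unfolding adjoint_operator_def
    using circ_dualD(2)[OF assms(2)] limitin_semigroup[OF assms(1) u] by simp
qed

text \<open>Since \<open>\<phi>\<close> is only known to be continuous along bounded sequences,
  continuity in time is tested sequentially. Convergent times stay in some [0,b], and this makes the
  corresponding orbit points norm-bounded.\<close>

lemma continuous_on_circ_dual_orbit:
  assumes "\<phi> \<in> circ_dual scaleK \<tau>"
  shows "continuous_on {0..} (\<lambda>t. blinfun_apply \<phi> (blinfun_apply (T t) x))"
proof (rule continuous_on_sequentiallyI)
  fix u a assume u: "\<forall>n. u n \<in> {0..}" "a \<in> {0..}" "u \<longlonglongrightarrow> (a::real)"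
  have "limitin (top_of_set {0..}) u a sequentially"
    using u by (simp add: limitin_subtopology)
  from continuous_map_limit[OF orbit_continuous[of x] this]
  have "limitin \<tau> (\<lambda>n. blinfun_apply (T (u n)) x) (blinfun_apply (T a) x) sequentially"
    by (simp add: o_def)
  moreover obtain b where "\<And>n. u n \<le> b"
    using convergent_imp_Bseq[OF convergentI[OF u(3)]] by (auto simp: Bseq_def abs_le_iff)
  then have "range (\<lambda>n. blinfun_apply (T (u n)) x) \<subseteq> (\<lambda>t. blinfun_apply (T t) x) ` {0..b}"
    using u(1) by auto
  then have "bounded (range (\<lambda>n. blinfun_apply (T (u n)) x))"
    using bounded_orbit bounded_subset by blast
  ultimately show "(\<lambda>n. blinfun_apply \<phi> (blinfun_apply (T (u n)) x))
      \<longlonglongrightarrow> blinfun_apply \<phi> (blinfun_apply (T a) x)"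
    using circ_dualD(2)[OF assms] by blast
qed

text \<open>Compactness is applied to the time interval: equicontinuity neighbourhoods of orbit
  points pull back to a cover of it. A finite subcover leaves finitely many orbit points, where
  pointwise convergence is simultaneous; the rest is an estimate with two halves of
  \<open>\<epsilon>\<close>.\<close>

lemma equicontinuous_uniformly_null_on_orbit:
  assumes eq: "equicontinuous_on_bounded \<tau> \<phi>"
    and null: "\<And>x. (\<lambda>n. blinfun_apply (\<phi> n) x) \<longlonglongrightarrow> 0"
    and "0 \<le> a" "\<epsilon> > 0"
  shows "\<forall>\<^sub>F n in sequentially. \<forall>t\<in>{a..b}. norm (blinfun_apply (\<phi> n) (blinfun_apply (T t) x)) < \<epsilon>"
proof -
  let ?o = "\<lambda>t. blinfun_apply (T t) x"
  let ?D = "?o ` {0..b}"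
  have "\<exists>U. openin \<tau> U \<and> y \<in> U \<and>
      (\<forall>z\<in>U \<inter> ?D. \<forall>n. norm (blinfun_apply (\<phi> n) z - blinfun_apply (\<phi> n) y) \<le> \<epsilon> / 2)"
    if "y \<in> ?D" for y
    using eq bounded_orbit[of x b] that \<open>\<epsilon> > 0\<close> unfolding equicontinuous_on_bounded_def
    by (meson UNIV_I half_gt_zero)
  then obtain U where U: "\<And>y. y \<in> ?D \<Longrightarrow> openin \<tau> (U y)" "\<And>y. y \<in> ?D \<Longrightarrow> y \<in> U y"
      "\<And>y z n. y \<in> ?D \<Longrightarrow> z \<in> U y \<Longrightarrow> z \<in> ?D
        \<Longrightarrow> norm (blinfun_apply (\<phi> n) z - blinfun_apply (\<phi> n) y) \<le> \<epsilon> / 2"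
    by (metis IntI)
  have D: "?o s \<in> ?D" if "s \<in> {a..b}" for s
    using that \<open>0 \<le> a\<close> by auto
  have cont: "continuous_map (top_of_set {a..b}) \<tau> ?o"
    using continuous_map_from_subtopology_mono[OF orbit_continuous[of x], of "{a..b}"] \<open>0 \<le> a\<close>
    by auto
  \<comment> \<open>The preimage is only relatively open; writing it as the trace of an open set of
    reals makes the compactness of \<open>{a..b}\<close> applicable.\<close>
  have "\<exists>G. open G \<and> {t \<in> {a..b}. ?o t \<in> U (?o s)} = {a..b} \<inter> G" if "s \<in> {a..b}" for s
    using openin_continuous_map_preimage[OF cont U(1)[OF D[OF that]]]
    by (simp add: openin_open)
  then obtain G where G: "\<And>s. s \<in> {a..b} \<Longrightarrow> open (G s)"
      "\<And>s. s \<in> {a..b} \<Longrightarrow> {t \<in> {a..b}. ?o t \<in> U (?o s)} = {a..b} \<inter> G s"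
    by metis
  have "s \<in> G s" if "s \<in> {a..b}" for s
    using G(2)[OF that] U(2)[OF D[OF that]] that by blast
  then have "{a..b} \<subseteq> (\<Union>s\<in>{a..b}. G s)" by blast
  then obtain E where E: "E \<subseteq> {a..b}" "finite E" "{a..b} \<subseteq> (\<Union>s\<in>E. G s)"
    using compactE_image[OF compact_Icc, of "{a..b}" G a b] G(1) by blast
  have "\<forall>\<^sub>F n in sequentially. \<forall>s\<in>E. norm (blinfun_apply (\<phi> n) (?o s)) < \<epsilon> / 2"
    using E(2) order_tendstoD(2)[OF tendsto_norm_zero[OF null], of "\<epsilon> / 2"] \<open>\<epsilon> > 0\<close>
    by (intro eventually_ball_finite) auto
  then show ?thesis
  proof eventually_elim
    case (elim n)
    show ?case
    proof
      fix t assume t: "t \<in> {a..b}"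
      then obtain s where s: "s \<in> E" "t \<in> G s"
        using E(3) by blast
      have s': "s \<in> {a..b}"
        using E(1) s(1) by blast
      have "?o t \<in> U (?o s)"
        using G(2)[OF s'] s(2) t by blast
      then have "norm (blinfun_apply (\<phi> n) (?o t) - blinfun_apply (\<phi> n) (?o s)) \<le> \<epsilon> / 2"
        by (rule U(3)[OF D[OF s'] _ D[OF t]])
      moreover have "norm (blinfun_apply (\<phi> n) (?o s)) < \<epsilon> / 2"
        using elim s(1) by blast
      ultimately show "norm (blinfun_apply (\<phi> n) (?o t)) < \<epsilon>"
        using norm_triangle_sub[of "blinfun_apply (\<phi> n) (?o t)" "blinfun_apply (\<phi> n) (?o s)"]
        by linarith
    qed
  qed
qed

end

theorem proposition2p4:
  fixes scaleK :: "'k::{real_normed_field,banach} \<Rightarrow> 'a::banach \<Rightarrow> 'a"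
    and \<tau> :: "'a topology"
    and T :: "real \<Rightarrow> 'a \<Rightarrow>\<^sub>L 'a"
  assumes "bi_admissible_space scaleK UNIV \<tau>"
    and A: "sequentially_complete_in (circ_topology scaleK \<tau>) (circ_dual scaleK \<tau> \<inter> cball 0 1)"
    and B: "\<And>\<phi>. \<lbrakk>range \<phi> \<subseteq> circ_dual scaleK \<tau>; bounded (range \<phi>);
                 limitin (circ_topology scaleK \<tau>) \<phi> 0 sequentially\<rbrakk>
              \<Longrightarrow> equicontinuous_on_bounded \<tau> \<phi>"
    and "bi_continuous_semigroup scaleK UNIV \<tau> (\<lambda>t. blinfun_apply (T t))"
  shows "bi_continuous_semigroup dual_scale (circ_dual scaleK \<tau>) (circ_topology scaleK \<tau>)
           (\<lambda>t. adjoint_operator (T t))"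
proof -
  interpret X: bi_continuous_semigroup_UNIV scaleK \<tau> T
    using assms(4) by (rule bi_continuous_semigroup_UNIV.intro)
  interpret circ: bi_admissible_space dual_scale "circ_dual scaleK \<tau>" "circ_topology scaleK \<tau>"
    by (rule bi_admissible_space_circ_dual[OF A])
  have norm_adj: "norm (adjoint_operator (T t) \<phi>) \<le> norm (T t) * norm \<phi>" for t and \<phi> :: "'a \<Rightarrow>\<^sub>L 'k"
    by (metis adjoint_operator_def mult.commute norm_blinfun_compose)
  show ?thesis
  proof
    fix t :: real assume t: "t \<ge> 0"
    show "bounded_operator_on dual_scale (circ_dual scaleK \<tau>) (adjoint_operator (T t))"
      unfolding bounded_operator_on_def linear_map_on_def
      using X.adjoint_in_circ_dual[OF t] norm_adj
      by (auto simp: adjoint_operator_def blinfun.add_left intro!: blinfun_eqI)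
  next
    fix \<phi> :: "'a \<Rightarrow>\<^sub>L 'k"
    show "adjoint_operator (T 0) \<phi> = \<phi>"
      by (rule blinfun_eqI) (simp add: adjoint_operator_def X.zero)
  next
    fix t s :: real and \<phi> :: "'a \<Rightarrow>\<^sub>L 'k"
    assume "t \<ge> 0" "s \<ge> 0"
    then show "adjoint_operator (T (t + s)) \<phi> = adjoint_operator (T t) (adjoint_operator (T s) \<phi>)"
      \<comment> \<open>Adjoints reverse the order of composition, so the semigroup law is used with
        the two times exchanged.\<close>
      using X.add[of s t]
      by (intro blinfun_eqI) (simp add: adjoint_operator_def add.commute)
  next
    fix \<phi> assume "\<phi> \<in> circ_dual scaleK \<tau>"
    then show "continuous_map (top_of_set {0..}) (circ_topology scaleK \<tau>) (\<lambda>t. adjoint_operator (T t) \<phi>)"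
      using X.continuous_on_circ_dual_orbit X.adjoint_in_circ_dual
      by (intro continuous_map_into_circ_topology) (auto simp: adjoint_operator_def)
  next
    obtain M where M: "M \<ge> 0"
        "\<And>t x. 0 \<le> t \<Longrightarrow> t \<le> 1 \<Longrightarrow> x \<in> UNIV \<Longrightarrow> norm (blinfun_apply (T t) x) \<le> M * norm x"
      by (rule X.bounded_on_interval[of 1]) blast
    have "norm (adjoint_operator (T t) \<phi>) \<le> M * norm \<phi>" if "t \<in> {0..1}" for t and \<phi> :: "'a \<Rightarrow>\<^sub>L 'k"
    proof -
      \<comment> \<open>The pointwise bound on [0,1] becomes a bound on operator norms, which passes
        to the adjoints.\<close>
      have "norm (T t) \<le> M"
        using M that by (intro norm_blinfun_bound) auto
      then show ?thesis
        using norm_adj[of t \<phi>] mult_right_mono[of "norm (T t)" M "norm \<phi>"] by simp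
    qed
    then show "\<exists>M. \<forall>t\<in>{0..1}. \<forall>\<phi>\<in>circ_dual scaleK \<tau>. norm (adjoint_operator (T t) \<phi>) \<le> M * norm \<phi>"
      by blast
  next
    fix \<phi> a b U
    assume \<phi>: "range \<phi> \<subseteq> circ_dual scaleK \<tau>" "bounded (range \<phi>)"
        "limitin (circ_topology scaleK \<tau>) \<phi> 0 sequentially"
      and ab: "0 \<le> a" "a \<le> (b::real)"
      and U: "openin (circ_topology scaleK \<tau>) U" "0 \<in> U"
    \<comment> \<open>Shrinking \<open>U\<close> to finitely many seminorms reduces the claim to
      uniform smallness of \<open>\<phi> n\<close> along the orbits of the finitely many points of
      \<open>F\<close>.\<close>
    obtain F \<epsilon> where F: "finite F" "\<epsilon> > 0"
        "{\<psi> \<in> circ_dual scaleK \<tau>. \<forall>x\<in>F. norm (blinfun_apply \<psi> x) < \<epsilon>} \<subseteq> U"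
      using U by (rule circ_topology_nbhd)
    have "(\<lambda>n. blinfun_apply (\<phi> n) x) \<longlonglongrightarrow> 0" for x
      using continuous_map_limit[OF continuous_map_circ_topology_eval[of _ _ x] \<phi>(3)]
      by (simp add: o_def)
    then have "\<forall>\<^sub>F n in sequentially. \<forall>x\<in>F. \<forall>t\<in>{a..b}.
        norm (blinfun_apply (\<phi> n) (blinfun_apply (T t) x)) < \<epsilon>"
      using F(1,2) ab(1) B[OF \<phi>]
      by (intro eventually_ball_finite ballI X.equicontinuous_uniformly_null_on_orbit)
    then show "\<forall>\<^sub>F n in sequentially. \<forall>t\<in>{a..b}. adjoint_operator (T t) (\<phi> n) \<in> U"
    proof eventually_elim
      case (elim n)
      \<comment> \<open>The seminorm ball is contained in \<open>U\<close> only within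
        \<open>circ_dual\<close>, so membership there has to be known as well.\<close>
      have "adjoint_operator (T t) (\<phi> n) \<in> circ_dual scaleK \<tau>" if "t \<in> {a..b}" for t
        using \<phi>(1) ab that by (intro X.adjoint_in_circ_dual) auto
      then show ?case
        using elim F(3) by (auto simp: adjoint_operator_def subset_iff)
    qed
  qed
qed

end
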